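(* Let $V_0,V_1,\dots$ be indeterminates and let $\mathbf{b}=(b_i)_{i\ge0}$, $\boldsymbol{\lambda}=(\lambda_i)_{i\ge1}$ be given by $b_i=-V_i^{-1}$ and $\lambda_i=V_i^{-1}V_{i-1}^{-1}$. For all integers $k\ge1$, $n\ge1$ and $0\le r,s\le 3k$, \[ \mu^{\le 3k}_{-n,r,s}(\mathbf{b},\boldsymbol{\lambda})=(-1)^{\lfloor (r+1)/3\rfloor+\lfloor (s+1)/3\rfloor+n}\frac{V_0\cdots V_s}{V_0\cdots V_{r-1}}\sum_{\pi\in\widetilde{\mathrm{PV}}^{3,3k}_{n-1,r,s}}\mathrm{wt}(\pi), \] where $V_0\cdots V_{r-1}=1$ if $r=0$.
   Context: A Motzkin path is a finite sequence of points in $\mathbb{Z}\times\mathbb{Z}_{\ge0}$ whose steps are each $(1,1)$, $(1,0)$ or $(1,-1)$; its weight is the product of $b_i$ over horizontal steps starting at height $i$ and $\lambda_i$ over down steps starting at height $i$. $\mu^{\le K}_{N,r,s}(\mathbf{b},\boldsymbol{\lambda})$ ($N\ge0$) is the sum of weights of Motzkin paths from $(0,r)$ to $(N,s)$ staying weakly below $y=K$. If $(f_N)_{N\ge0}$ satisfies $f_N=c_1f_{N-1}+\cdots+c_df_{N-d}$ for all $N\ge d$ with $c_d\ne0$, it is extended uniquely to all $N\in\mathbb{Z}$ so the recurrence holds for all $N$; $\mu^{\le K}_{-N,r,s}$ denotes this extension (it exists here). $\mathrm{wt}((a_1,\dots,a_N))=V_{a_1}\cdots V_{a_N}$ (empty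 sequence: $1$). A modified $(3,r,s)$-peak-valley sequence is a sequence $(a_1,\dots,a_N)$ of nonnegative integers such that, setting $a_0=r$ and $a_{N+1}=s$, for each $i=0,\dots,N+1$: if $a_i\equiv1\pmod3$ then $a_{i-1}>a_i<a_{i+1}$, and if $a_i\equiv2\pmod3$ then $a_{i-1}<a_i>a_{i+1}$, where inequalities involving $a_{-1}$ or $a_{N+2}$ are ignored. $\widetilde{\mathrm{PV}}^{3,K}_{N,r,s}$ is the set of such sequences with $0\le a_i\le K$ for all $i$. *)

theory Defs
  imports
    Complex_Main
    "HOL-Library.Poly_Mapping"
    "HOL-Computational_Algebra.Fraction_Field"
begin

section \<open>Indeterminates\<close>

text \<open>
  The polynomial ring over \<open>'k\<close> in countably many indeterminates is the monoid algebra
  \<open>(nat \<Rightarrow>\<^sub>0 nat) \<Rightarrow>\<^sub>0 'k\<close> (finitely supported maps from exponent vectors to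
  coefficients), and \<open>'k ratfun\<close> is its field of fractions \<open>k(V\<^sub>0, V\<^sub>1, ...)\<close>.
\<close>

type_synonym 'k ratfun = "((nat \<Rightarrow>\<^sub>0 nat) \<Rightarrow>\<^sub>0 'k) fract"

definition indet :: "nat \<Rightarrow> 'k::field ratfun" where
  "indet i = Fract (Poly_Mapping.single (Poly_Mapping.single i 1) 1) 1"


section \<open>Bounded Motzkin paths\<close>

fun motzkin_step :: "int \<times> nat \<Rightarrow> int \<times> nat \<Rightarrow> bool" where
  "motzkin_step (x, y) (x', y') \<longleftrightarrow> x' = x + 1 \<and> (y' = y + 1 \<or> y' = y \<or> y = y' + 1)"

definition motzkin_path :: "(int \<times> nat) list \<Rightarrow> bool" where
  "motzkin_path p \<longleftrightarrow>
     p \<noteq> [] \<and> (\<forall>i. Suc i < length p \<longrightarrow> motzkin_step (p ! i) (p ! Suc i))"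

definition motzkin_paths :: "nat \<Rightarrow> nat \<Rightarrow> nat \<Rightarrow> nat \<Rightarrow> (int \<times> nat) list set" where
  "motzkin_paths K N r s =
     {p. motzkin_path p \<and> hd p = (0, r) \<and> last p = (int N, s) \<and> (\<forall>z\<in>set p. snd z \<le> K)}"

text \<open>
  The value \<open>lam 0\<close> is never used on a path, since heights are nonnegative.
\<close>

definition step_weight ::
  "(nat \<Rightarrow> 'a::comm_ring_1) \<Rightarrow> (nat \<Rightarrow> 'a) \<Rightarrow> int \<times> nat \<Rightarrow> int \<times> nat \<Rightarrow> 'a" where
  "step_weight b lam u v =
     (if snd v = snd u then b (snd u) else if snd v < snd u then lam (snd u) else 1)"

definition path_weight ::
  "(nat \<Rightarrow> 'a::comm_ring_1) \<Rightarrow> (nat \<Rightarrow> 'a) \<Rightarrow> (int \<times> nat) list \<Rightarrow> 'a" where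
  "path_weight b lam p = (\<Prod>i<length p - 1. step_weight b lam (p ! i) (p ! Suc i))"

definition mu ::
  "nat \<Rightarrow> (nat \<Rightarrow> 'a::comm_ring_1) \<Rightarrow> (nat \<Rightarrow> 'a) \<Rightarrow> nat \<Rightarrow> nat \<Rightarrow> nat \<Rightarrow> 'a" where
  "mu K b lam N r s = (\<Sum>p\<in>motzkin_paths K N r s. path_weight b lam p)"

text \<open>The sum above ranges over a finite set, so it is not a sum that defaults to 0.\<close>

lemma motzkin_path_fst:
  assumes "motzkin_path p" "hd p = (0, r)" "i < length p"
  shows "fst (p ! i) = int i"
  using assms(3)
proof (induction i)
  case 0
  then show ?case using assms by (simp add: motzkin_path_def hd_conv_nth)
next
  case (Suc i)
  then have "motzkin_step (p ! i) (p ! Suc i)"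
    using assms(1) by (simp add: motzkin_path_def)
  then show ?case using Suc by (cases "p ! i"; cases "p ! Suc i") auto
qed

lemma length_motzkin_paths:
  assumes "p \<in> motzkin_paths K N r s"
  shows "length p = Suc N"
proof -
  have "p \<noteq> []" "motzkin_path p" "hd p = (0, r)" "last p = (int N, s)"
    using assms by (auto simp: motzkin_paths_def motzkin_path_def)
  then have "int (length p - 1) = int N"
    using motzkin_path_fst[of p r "length p - 1"] by (simp add: last_conv_nth)
  then show ?thesis using \<open>p \<noteq> []\<close> by (cases p) auto
qed

lemma finite_motzkin_paths: "finite (motzkin_paths K N r s)"
proof (rule finite_subset)
  let ?A = "(int ` {..N}) \<times> {..K}"
  show "finite {p. set p \<subseteq> ?A \<and> length p = Suc N}"
    by (rule finite_lists_length_eq) simp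
  show "motzkin_paths K N r s \<subseteq> {p. set p \<subseteq> ?A \<and> length p = Suc N}"
  proof
    fix p assume p: "p \<in> motzkin_paths K N r s"
    have len: "length p = Suc N" using p by (rule length_motzkin_paths)
    have "z \<in> ?A" if z: "z \<in> set p" for z
    proof -
      obtain i where i: "i < length p" "z = p ! i" using z by (auto simp: in_set_conv_nth)
      have "fst z = int i"
        using motzkin_path_fst[of p r i] p i by (simp add: motzkin_paths_def)
      moreover have "snd z \<le> K" using p z by (auto simp: motzkin_paths_def)
      ultimately show ?thesis using i len by (auto simp: mem_Times_iff)
    qed
    then show "p \<in> {p. set p \<subseteq> ?A \<and> length p = Suc N}" using len by auto
  qed
qed


section \<open>Extending linearly recurrent sequences to negative indices\<close>

definition is_recurrence_extension :: "(nat \<Rightarrow> 'a::field) \<Rightarrow> (int \<Rightarrow> 'a) \<Rightarrow> bool" where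
  "is_recurrence_extension f g \<longleftrightarrow>
     (\<exists>d\<ge>1. \<exists>c. c d \<noteq> 0 \<and>
        (\<forall>N\<ge>d. f N = (\<Sum>i=1..d. c i * f (N - i))) \<and>
        (\<forall>N. g (int N) = f N) \<and>
        (\<forall>N. g N = (\<Sum>i=1..d. c i * g (N - int i))))"

definition recurrence_extension :: "(nat \<Rightarrow> 'a::field) \<Rightarrow> int \<Rightarrow> 'a" where
  "recurrence_extension f = (THE g. is_recurrence_extension f g)"

text \<open>
  The extension does not depend on the choice of the recurrence, which justifies the
  definite description.
\<close>

lemma backward_zero:
  fixes h :: "int \<Rightarrow> 'a::field"
  assumes d: "d \<ge> 1" "c d \<noteq> 0"
    and rec: "\<And>N. h N = (\<Sum>i=1..d. c i * h (N - int i))"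
    and zero: "\<And>N. N \<ge> M \<Longrightarrow> h N = 0"
  shows "h N = 0"
proof -
  have *: "\<forall>N\<ge>M - int m. h N = 0" for m
  proof (induction m)
    case 0
    then show ?case using zero by simp
  next
    case (Suc m)
    let ?L = "M - int (Suc m)"
    have z: "h N = 0" if "N > ?L" for N using Suc that by auto
    have "h (?L + int d) = 0" using z d by simp
    moreover have "h (?L + int d) = (\<Sum>i=1..d. c i * h (?L + int d - int i))" by (rule rec)
    moreover have "\<dots> = (\<Sum>i\<in>{d}. c i * h (?L + int d - int i))"
      by (rule sum.mono_neutral_right) (use d in \<open>auto intro!: z\<close>)
    ultimately have "h ?L = 0" using d by simp
    then show ?case using z by (metis order_le_less)
  qed
  show ?thesis using *[of "nat (M - N)"] by auto
qed

lemma is_recurrence_extension_unique: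
  assumes "is_recurrence_extension f g" "is_recurrence_extension f g'"
  shows "g = g'"
proof -
  obtain d c where d: "d \<ge> 1" "c d \<noteq> 0"
    and f: "\<And>N. g (int N) = f N"
    and g: "\<And>N. g N = (\<Sum>i=1..d. c i * g (N - int i))"
    using assms(1) unfolding is_recurrence_extension_def by blast
  obtain d' c' where d': "d' \<ge> 1" "c' d' \<noteq> 0"
    and rf: "\<And>N. N \<ge> d' \<Longrightarrow> f N = (\<Sum>i=1..d'. c' i * f (N - i))"
    and f': "\<And>N. g' (int N) = f N"
    and g': "\<And>N. g' N = (\<Sum>i=1..d'. c' i * g' (N - int i))"
    using assms(2) unfolding is_recurrence_extension_def by blast
  define h where "h N = g N - (\<Sum>j=1..d'. c' j * g (N - int j))" for N
  have "h N = 0" for N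
  proof (rule backward_zero[of d c h "int d'"])
    show "d \<ge> 1" "c d \<noteq> 0" by (fact d)+
    fix N
    have "(\<Sum>j=1..d'. c' j * g (N - int j))
        = (\<Sum>j=1..d'. \<Sum>i=1..d. c' j * (c i * g (N - int j - int i)))"
      by (subst g) (simp add: sum_distrib_left)
    also have "\<dots> = (\<Sum>i=1..d. c i * (\<Sum>j=1..d'. c' j * g (N - int i - int j)))"
      by (subst sum.swap) (simp add: sum_distrib_left algebra_simps)
    finally show "h N = (\<Sum>i=1..d. c i * h (N - int i))"
      unfolding h_def using g[of N] by (simp add: right_diff_distrib sum_subtractf)
  next
    fix N :: int assume N: "N \<ge> int d'"
    then obtain n where n: "N = int n" "n \<ge> d'" by (metis nonneg_int_cases of_nat_0_le_iff
      of_nat_le_iff order_trans)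
    have "g (N - int j) = f (n - j)" if "j \<in> {1..d'}" for j
      using f[of "n - j"] that n by (simp add: of_nat_diff)
    then show "h N = 0"
      unfolding h_def using rf[OF n(2)] f[of n] n by simp
  qed
  then have gc': "g N = (\<Sum>j=1..d'. c' j * g (N - int j))" for N
    unfolding h_def by (metis eq_iff_diff_eq_0)
  have "g N - g' N = 0" for N
  proof (rule backward_zero[of d' c' "\<lambda>N. g N - g' N" 0])
    show "d' \<ge> 1" "c' d' \<noteq> 0" by (fact d')+
    fix N
    show "g N - g' N = (\<Sum>i=1..d'. c' i * (g (N - int i) - g' (N - int i)))"
      using gc'[of N] g'[of N] by (simp add: right_diff_distrib sum_subtractf)
  next
    fix N :: int assume "N \<ge> 0"
    then show "g N - g' N = 0" using f[of "nat N"] f'[of "nat N"] by simp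
  qed
  then show ?thesis by (simp add: fun_eq_iff)
qed

lemma recurrence_extension_eq:
  assumes "is_recurrence_extension f g"
  shows "recurrence_extension f = g"
  unfolding recurrence_extension_def
  using assms is_recurrence_extension_unique by blast

definition mu_int ::
  "nat \<Rightarrow> (nat \<Rightarrow> 'a::field) \<Rightarrow> (nat \<Rightarrow> 'a) \<Rightarrow> int \<Rightarrow> nat \<Rightarrow> nat \<Rightarrow> 'a" where
  "mu_int K b lam N r s = recurrence_extension (\<lambda>m. mu K b lam m r s) N"


section \<open>Modified peak-valley sequences\<close>

text \<open>
  With \<open>e = r # a @ [s]\<close>, the entry \<open>e ! i\<close> is \<open>a\<^sub>i\<close> for \<open>0 \<le> i \<le> N + 1\<close>,
  including the conventions \<open>a\<^sub>0 = r\<close> and \<open>a\<^sub>N\<^sub>+\<^sub>1 = s\<close>.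
\<close>

definition modified_pv3 :: "nat \<Rightarrow> nat \<Rightarrow> nat list \<Rightarrow> bool" where
  "modified_pv3 r s a \<longleftrightarrow>
     (let e = r # a @ [s]; N = length a in
       \<forall>i\<le>N + 1.
         (e ! i mod 3 = 1 \<longrightarrow>
            (i \<noteq> 0 \<longrightarrow> e ! (i - 1) > e ! i) \<and> (i \<noteq> N + 1 \<longrightarrow> e ! i < e ! (i + 1))) \<and>
         (e ! i mod 3 = 2 \<longrightarrow>
            (i \<noteq> 0 \<longrightarrow> e ! (i - 1) < e ! i) \<and> (i \<noteq> N + 1 \<longrightarrow> e ! i > e ! (i + 1))))"

definition modified_PV3 :: "nat \<Rightarrow> nat \<Rightarrow> nat \<Rightarrow> nat \<Rightarrow> nat list set" where
  "modified_PV3 K N r s = {a. length a = N \<and> modified_pv3 r s a \<and> (\<forall>x\<in>set a. x \<le> K)}"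

lemma finite_modified_PV3: "finite (modified_PV3 K N r s)"
  by (rule finite_subset[OF _ finite_lists_length_eq[of "{..K}" N]])
     (auto simp: modified_PV3_def)

definition pv_weight :: "(nat \<Rightarrow> 'a::comm_ring_1) \<Rightarrow> nat list \<Rightarrow> 'a" where
  "pv_weight V a = prod_list (map V a)"

end

theory Submission
  imports Defs
begin

text \<open>
  Motzkin paths below height \<open>3k\<close> are counted by the powers of a tridiagonal matrix \<open>A\<close>. For the given
  weights, conjugating by the diagonal matrix with entries \<open>V\<^sub>0 \<cdots> V\<^sub>x\<^sub>-\<^sub>1\<close> and extracting the factor
  \<open>1 / V\<^sub>x\<close> from row \<open>x\<close> turns \<open>A\<close> into the integer matrix with \<open>-1\<close> on the diagonal and \<open>1\<close> next to
  it. The inverse of that matrix has entries \<open>0\<close> and \<open>\<plusminus>1\<close>, supported exactly on the pairs \<open>(x, y)\<close> that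
  may be adjacent in a modified peak-valley sequence. In \<open>A\<^sup>-\<^sup>n\<close> the signs of the intermediate indices
  cancel and each of them contributes one factor \<open>V\<^sub>x\<close>. The extension of the entries of \<open>A\<^sup>N\<close>
  to negative \<open>N\<close> by a linear recurrence is given by the powers of \<open>A\<^sup>-\<^sup>1\<close>.
\<close>

section \<open>Bounded Motzkin paths as matrix powers\<close>

text \<open>Transfer matrix of one step: the truncated Jacobi matrix of the three-term recurrence
  with coefficients b and lam.\<close>

definition jacobi_entry ::
  "(nat \<Rightarrow> 'a::comm_ring_1) \<Rightarrow> (nat \<Rightarrow> 'a) \<Rightarrow> nat \<Rightarrow> nat \<Rightarrow> 'a" where
  "jacobi_entry b lam x y =
     (if y = x then b x else if x = Suc y then lam x else if y = Suc x then 1 else 0)"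

lemma motzkin_path_append:
  assumes "p \<noteq> []"
  shows "motzkin_path (p @ [z]) \<longleftrightarrow> motzkin_path p \<and> motzkin_step (last p) z"
proof -
  have "motzkin_path q \<longleftrightarrow> q \<noteq> [] \<and> successively motzkin_step q" for q
    by (simp add: motzkin_path_def successively_conv_nth)
  with assms show ?thesis
    by (simp add: successively_append_iff)
qed

lemma path_weight_append:
  assumes "p \<noteq> []"
  shows "path_weight b lam (p @ [z]) = path_weight b lam p * step_weight b lam (last p) z"
proof -
  obtain n where n: "length p = Suc n"
    using assms by (cases p) auto
  then have "(\<Prod>i<n. step_weight b lam ((p @ [z]) ! i) ((p @ [z]) ! Suc i))
      = (\<Prod>i<n. step_weight b lam (p ! i) (p ! Suc i))"
    by (intro prod.cong) (auto simp: nth_append)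
  with n assms show ?thesis
    by (simp add: path_weight_def nth_append last_conv_nth)
qed

text \<open>The bound on r matters: the one-point path must itself respect the ceiling K.\<close>

lemma mu_0:
  assumes "r \<le> K"
  shows "mu K b lam 0 r s = (if r = s then 1 else 0)"
proof -
  have "p = [(0, r)] \<and> r = s" if "p \<in> motzkin_paths K 0 r s" for p
    using length_motzkin_paths[OF that] that
    by (auto simp: motzkin_paths_def length_Suc_conv)
  moreover have "[(0, r)] \<in> motzkin_paths K 0 r r"
    using assms by (auto simp: motzkin_paths_def motzkin_path_def)
  ultimately have "motzkin_paths K 0 r s = (if r = s then {[(0, r)]} else {})"
    by auto
  then show ?thesis
    by (simp add: mu_def path_weight_def)
qed

lemma motzkin_paths_Suc:
  assumes "s \<le> K"
  shows "motzkin_paths K (Suc N) r s =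
    (\<Union>l\<in>{l. l \<le> K \<and> (s = Suc l \<or> s = l \<or> l = Suc s)}.
       (\<lambda>p. p @ [(int N + 1, s)]) ` motzkin_paths K N r l)" (is "?L = ?R")
proof
  show "?L \<subseteq> ?R"
  proof
    fix q assume q: "q \<in> ?L"
    have "length q = Suc (Suc N)"
      using q by (rule length_motzkin_paths)
    then obtain p z where pz: "q = p @ [z]" "length p = Suc N"
      by (metis length_Suc_conv_rev)
    then have "p \<noteq> []" by auto
    then have mp: "motzkin_path p" "motzkin_step (last p) z" "z = (int N + 1, s)"
      "hd p = (0, r)" "\<forall>x\<in>set p. snd x \<le> K"
      using q pz by (auto simp: motzkin_paths_def motzkin_path_append)
    obtain l where l: "last p = (int N, l)" "s = Suc l \<or> s = l \<or> l = Suc s"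
      using mp by (cases "last p") auto
    have "l \<le> K"
      using last_in_set[OF \<open>p \<noteq> []\<close>] mp(5) l(1) by force
    moreover have "p \<in> motzkin_paths K N r l"
      using mp l by (simp add: motzkin_paths_def)
    ultimately show "q \<in> ?R"
      using l pz mp by blast
  qed
  show "?R \<subseteq> ?L"
  proof
    fix q assume "q \<in> ?R"
    then obtain l p where l: "s = Suc l \<or> s = l \<or> l = Suc s"
      and p: "p \<in> motzkin_paths K N r l" "q = p @ [(int N + 1, s)]"
      by blast
    moreover have "p \<noteq> []"
      using p by (auto simp: motzkin_paths_def motzkin_path_def)
    ultimately show "q \<in> ?L"
      using assms by (auto simp: motzkin_paths_def motzkin_path_append)
  qed
qed

text \<open>Splitting off the last step: the row \<open>mu K b lam N r\<close> is multiplied on the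
  right by the transfer matrix. The ceiling enters only through the range of l.\<close>

lemma mu_Suc:
  assumes "s \<le> K"
  shows "mu K b lam (Suc N) r s = (\<Sum>l\<le>K. mu K b lam N r l * jacobi_entry b lam l s)"
proof -
  let ?I = "{l. l \<le> K \<and> (s = Suc l \<or> s = l \<or> l = Suc s)}"
  let ?e = "\<lambda>p. p @ [(int N + 1, s)]"
  have last: "p \<noteq> [] \<and> last p = (int N, l)" if "p \<in> motzkin_paths K N r l" for p l
    using that by (auto simp: motzkin_paths_def motzkin_path_def)
  have disjoint: "l = l'" if "p \<in> motzkin_paths K N r l" "p \<in> motzkin_paths K N r l'" for p l l'
    using last[OF that(1)] last[OF that(2)] by simp
  have "mu K b lam (Suc N) r s
      = (\<Sum>l\<in>?I. \<Sum>q\<in>?e ` motzkin_paths K N r l. path_weight b lam q)"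
    unfolding mu_def motzkin_paths_Suc[OF assms]
    by (rule sum.UNION_disjoint) (use disjoint in \<open>auto simp: finite_motzkin_paths\<close>)
  also have "\<dots> = (\<Sum>l\<in>?I. mu K b lam N r l * jacobi_entry b lam l s)"
  proof (rule sum.cong)
    fix l assume l: "l \<in> ?I"
    have "(\<Sum>q\<in>?e ` motzkin_paths K N r l. path_weight b lam q)
        = (\<Sum>p\<in>motzkin_paths K N r l. path_weight b lam (?e p))"
      by (subst sum.reindex) (auto simp: inj_on_def)
    also have "\<dots> = (\<Sum>p\<in>motzkin_paths K N r l. path_weight b lam p * jacobi_entry b lam l s)"
    proof (rule sum.cong)
      fix p assume "p \<in> motzkin_paths K N r l"
      then have "p \<noteq> []" "last p = (int N, l)" using last by auto
      then show "path_weight b lam (?e p) = path_weight b lam p * jacobi_entry b lam l s"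
        using l by (auto simp: path_weight_append step_weight_def jacobi_entry_def)
    qed simp
    finally show "(\<Sum>q\<in>?e ` motzkin_paths K N r l. path_weight b lam q)
        = mu K b lam N r l * jacobi_entry b lam l s"
      by (simp add: mu_def sum_distrib_right)
  qed simp
  also have "\<dots> = (\<Sum>l\<le>K. mu K b lam N r l * jacobi_entry b lam l s)"
    by (rule sum.mono_neutral_left) (auto simp: jacobi_entry_def)
  finally show ?thesis .
qed


section \<open>Modified peak-valley sequences as walks\<close>

text \<open>Each clause involves a single neighbour, so the peak and valley conditions can be
  regrouped by consecutive pairs. The relation is symmetric, which \<open>tri_inverse_left\<close>
  uses.\<close>

definition pv_adj :: "nat \<Rightarrow> nat \<Rightarrow> bool" where
  "pv_adj x y \<longleftrightarrow> (x mod 3 = 1 \<longrightarrow> x < y) \<and> (y mod 3 = 1 \<longrightarrow> y < x) \<and>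
     (x mod 3 = 2 \<longrightarrow> y < x) \<and> (y mod 3 = 2 \<longrightarrow> x < y)"

lemma modified_pv3_iff: "modified_pv3 r s a \<longleftrightarrow> successively pv_adj (r # a @ [s])"
proof -
  define e where "e = r # a @ [s]"
  define N where "N = length a"
  have "modified_pv3 r s a \<longleftrightarrow> (\<forall>i\<le>N. pv_adj (e ! i) (e ! Suc i))"
  proof
    assume m: "modified_pv3 r s a"
    show "\<forall>i\<le>N. pv_adj (e ! i) (e ! Suc i)"
    proof (intro allI impI)
      fix i assume "i \<le> N"
      moreover have "i \<le> N + 1 \<Longrightarrow>
         (e ! i mod 3 = 1 \<longrightarrow> (i \<noteq> N + 1 \<longrightarrow> e ! i < e ! (i + 1))) \<and>
         (e ! i mod 3 = 2 \<longrightarrow> (i \<noteq> N + 1 \<longrightarrow> e ! i > e ! (i + 1)))"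
        using m by (simp add: modified_pv3_def e_def N_def Let_def)
      \<comment> \<open>The pair at i takes its second half from the condition at position i + 1,
        looking left.\<close>
      moreover have "Suc i \<le> N + 1 \<Longrightarrow>
         (e ! Suc i mod 3 = 1 \<longrightarrow> e ! i > e ! Suc i) \<and>
         (e ! Suc i mod 3 = 2 \<longrightarrow> e ! i < e ! Suc i)"
        using m[unfolded modified_pv3_def Let_def, rule_format, of "Suc i"]
        by (auto simp: e_def N_def)
      ultimately show "pv_adj (e ! i) (e ! Suc i)"
        by (simp add: pv_adj_def)
    qed
  next
    assume *: "\<forall>i\<le>N. pv_adj (e ! i) (e ! Suc i)"
    have "(e ! i mod 3 = 1 \<longrightarrow>
            (i \<noteq> 0 \<longrightarrow> e ! (i - 1) > e ! i) \<and> (i \<noteq> N + 1 \<longrightarrow> e ! i < e ! (i + 1))) \<and>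
         (e ! i mod 3 = 2 \<longrightarrow>
            (i \<noteq> 0 \<longrightarrow> e ! (i - 1) < e ! i) \<and> (i \<noteq> N + 1 \<longrightarrow> e ! i > e ! (i + 1)))"
      if "i \<le> N + 1" for i
    proof -
      have "i \<noteq> N + 1 \<Longrightarrow> pv_adj (e ! i) (e ! (i + 1))"
        using * that by simp
      moreover have "i \<noteq> 0 \<Longrightarrow> pv_adj (e ! (i - 1)) (e ! i)"
        using *[rule_format, of "i - 1"] that by simp
      ultimately show ?thesis
        by (auto simp: pv_adj_def)
    qed
    then show "modified_pv3 r s a"
      unfolding modified_pv3_def Let_def e_def N_def by blast
  qed
  also have "\<dots> \<longleftrightarrow> successively pv_adj e"
    by (simp add: successively_conv_nth e_def N_def less_Suc_eq_le)
  finally show ?thesis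
    by (simp only: e_def)
qed

definition pv_sum :: "nat \<Rightarrow> (nat \<Rightarrow> 'a::comm_ring_1) \<Rightarrow> nat \<Rightarrow> nat \<Rightarrow> nat \<Rightarrow> 'a" where
  "pv_sum K V N r s = (\<Sum>a\<in>modified_PV3 K N r s. pv_weight V a)"

lemma pv_sum_0: "pv_sum K V 0 r s = of_bool (pv_adj r s)"
proof -
  have "modified_PV3 K 0 r s = (if pv_adj r s then {[]} else {})"
    by (auto simp: modified_PV3_def modified_pv3_iff)
  then show ?thesis
    by (simp add: pv_sum_def pv_weight_def)
qed

lemma modified_PV3_Suc:
  "modified_PV3 K (Suc N) r s =
    (\<Union>l\<in>{l. l \<le> K \<and> pv_adj l s}. (\<lambda>a. a @ [l]) ` modified_PV3 K N r l)"
  (is "?L = ?R")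
proof
  show "?L \<subseteq> ?R"
  proof
    fix q assume q: "q \<in> ?L"
    then obtain a l where a: "q = a @ [l]" "length a = N"
      by (auto simp: modified_PV3_def length_Suc_conv_rev)
    have "successively pv_adj ((r # a @ [l]) @ [s])"
      using q a by (simp add: modified_PV3_def modified_pv3_iff)
    then have "successively pv_adj (r # a @ [l])" "pv_adj l s"
      unfolding successively_append_iff by auto
    then show "q \<in> ?R"
      using q a by (auto simp: modified_PV3_def modified_pv3_iff)
  qed
  show "?R \<subseteq> ?L"
  proof
    fix q assume "q \<in> ?R"
    then obtain a l where a: "q = a @ [l]" "l \<le> K" "pv_adj l s" "a \<in> modified_PV3 K N r l"
      by blast
    then have "successively pv_adj (r # a @ [l])"
      by (simp add: modified_PV3_def modified_pv3_iff)
    then have "successively pv_adj ((r # a @ [l]) @ [s])"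
      unfolding successively_append_iff using a by simp
    then show "q \<in> ?L"
      using a by (auto simp: modified_PV3_def modified_pv3_iff)
  qed
qed

text \<open>The right endpoint l of a shorter sequence becomes an interior entry and only then
  contributes its weight \<open>V l\<close>.\<close>

lemma pv_sum_Suc:
  "pv_sum K V (Suc N) r s = (\<Sum>l\<le>K. pv_sum K V N r l * V l * of_bool (pv_adj l s))"
proof -
  have "pv_sum K V (Suc N) r s
      = (\<Sum>l\<in>{l. l \<le> K \<and> pv_adj l s}. \<Sum>a\<in>(\<lambda>a. a @ [l]) ` modified_PV3 K N r l. pv_weight V a)"
    unfolding pv_sum_def modified_PV3_Suc
    by (rule sum.UNION_disjoint) (auto simp: finite_modified_PV3)
  also have "\<dots> = (\<Sum>l\<in>{l. l \<le> K \<and> pv_adj l s}. pv_sum K V N r l * V l * of_bool (pv_adj l s))"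
    by (intro sum.cong)
       (auto simp: sum.reindex inj_on_def pv_sum_def pv_weight_def sum_distrib_right)
  also have "\<dots> = (\<Sum>l\<le>K. pv_sum K V N r l * V l * of_bool (pv_adj l s))"
    by (rule sum.mono_neutral_left) auto
  finally show ?thesis .
qed


section \<open>Inverting a tridiagonal matrix\<close>

definition tri_entry :: "nat \<Rightarrow> nat \<Rightarrow> 'a::comm_ring_1" where
  "tri_entry x y = (if x = y then -1 else if x = Suc y \<or> y = Suc x then 1 else 0)"

text \<open>The exponent counts the j \<le> x with j congruent to 2 mod 3, so the sign flips exactly
  at these j.\<close>

definition pv_sign :: "nat \<Rightarrow> 'a::comm_ring_1" where
  "pv_sign x = (-1) ^ ((x + 1) div 3)"

definition tri_inv_entry :: "nat \<Rightarrow> nat \<Rightarrow> 'a::comm_ring_1" where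
  "tri_inv_entry x y = - (pv_sign x * pv_sign y * of_bool (pv_adj x y))"

lemma pv_sign_square [simp]: "pv_sign x * pv_sign x = 1" "pv_sign x * (pv_sign x * y) = y"
  by (simp_all add: pv_sign_def flip: power_add mult.assoc)

lemma mod3_cases:
  fixes x :: nat
  obtains a where "x = 3 * a" | a where "x = 3 * a + 1" | a where "x = 3 * a + 2"
  by (metis One_nat_def add.commute add_0 less_2_cases less_Suc_eq mod_less_divisor
      mult_div_mod_eq numeral_3_eq_3 numeral_2_eq_2 zero_less_Suc)

lemma pv_sign_simps:
  "pv_sign (3 * a) = (-1) ^ a" "pv_sign (Suc (3 * a)) = (-1) ^ a"
  "pv_sign (Suc (Suc (3 * a))) = - ((-1) ^ a)"
  "pv_sign (Suc (Suc (Suc (3 * a)))) = - ((-1) ^ a)"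
  "pv_sign (Suc (Suc (Suc (Suc (3 * a))))) = - ((-1) ^ a)"
proof -
  have "Suc (3 * a) div 3 = a" "Suc (Suc (3 * a)) div 3 = a"
    by presburger+
  then show "pv_sign (3 * a) = (-1) ^ a" "pv_sign (Suc (3 * a)) = (-1) ^ a"
    "pv_sign (Suc (Suc (3 * a))) = - ((-1) ^ a)"
    "pv_sign (Suc (Suc (Suc (3 * a)))) = - ((-1) ^ a)"
    "pv_sign (Suc (Suc (Suc (Suc (3 * a))))) = - ((-1) ^ a)"
    by (simp_all add: pv_sign_def)
qed

text \<open>Rows 0 and 1 of the inverse differ only in column 0.\<close>

lemma tri_inv_entry_rec0: "- tri_inv_entry 0 y + tri_inv_entry 1 y = of_bool (y = 0)"
  by (rule mod3_cases[of y])
     (auto simp: tri_inv_entry_def pv_adj_def pv_sign_def)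

lemma triple_mod_simps: "Suc (3 * a) mod 3 = 1" "Suc (Suc (3 * a)) mod 3 = 2"
  "Suc (Suc (Suc (3 * a))) mod 3 = 0" "Suc (Suc (Suc (Suc (3 * a)))) mod 3 = 1"
  by presburger+

text \<open>Arithmetic for the nine residue cases of \<open>tri_inv_entry_rec\<close>, in the
  successor form met there.\<close>

lemma triple_compare:
  fixes a b :: nat
  shows "3 * a < Suc (3 * b) \<longleftrightarrow> a \<le> b" "3 * a < Suc (Suc (3 * b)) \<longleftrightarrow> a \<le> b"
    "3 * a < Suc (Suc (Suc (3 * b))) \<longleftrightarrow> a \<le> b"
    "3 * a < Suc (Suc (Suc (Suc (3 * b)))) \<longleftrightarrow> a \<le> Suc b"
    "Suc (3 * a) < 3 * b \<longleftrightarrow> a < b" "Suc (Suc (3 * a)) < 3 * b \<longleftrightarrow> a < b"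
    "Suc (Suc (Suc (3 * a))) < 3 * b \<longleftrightarrow> Suc a < b"
    "Suc (Suc (Suc (Suc (3 * a)))) < 3 * b \<longleftrightarrow> Suc a < b"
    "3 * a \<noteq> Suc (3 * b)" "Suc (3 * a) \<noteq> 3 * b"
    "3 * a \<noteq> Suc (Suc (3 * b))" "Suc (Suc (3 * a)) \<noteq> 3 * b"
    "3 * a = Suc (Suc (Suc (3 * b))) \<longleftrightarrow> a = Suc b"
  by presburger+

text \<open>In a column y < x or y > x + 2 either all three terms vanish, or exactly two survive and
  cancel by their signs. The columns in between are checked by residues.\<close>

lemma tri_inv_entry_rec:
  "tri_inv_entry x y - tri_inv_entry (Suc x) y + tri_inv_entry (Suc (Suc x)) y
    = of_bool (y = Suc x)"
proof -
  have sq: "(-1 :: 'a) ^ a * (-1) ^ a = 1" for a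
    by (simp flip: power_add)
  show ?thesis
    by (rule mod3_cases[of x]; rule mod3_cases[of y])
       (auto simp: tri_inv_entry_def pv_adj_def pv_sign_simps triple_mod_simps triple_compare sq)
qed

text \<open>The condition \<open>f (Suc K) = 0\<close> lets the truncated last row obey the same
  three-term formula as the others.\<close>

lemma sum_tri_entry:
  assumes "x \<le> K" "f (Suc K) = 0"
  shows "(\<Sum>l\<le>K. tri_entry x l * f l) = (if x = 0 then 0 else f (x - 1)) - f x + f (Suc x)"
proof -
  have "(\<Sum>l\<le>K. tri_entry x l * f l) = (\<Sum>l\<le>Suc K. tri_entry x l * f l)"
    using assms by simp
  also have "\<dots> = (\<Sum>l\<in>insert x (insert (Suc x) (if x = 0 then {} else {x - 1})).
      tri_entry x l * f l)"
    by (rule sum.mono_neutral_right) (use assms in \<open>auto simp: tri_entry_def\<close>)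
  also have "\<dots> = (if x = 0 then 0 else f (x - 1)) - f x + f (Suc x)"
    by (auto simp: tri_entry_def)
  finally show ?thesis .
qed

lemma tri_inverse_right:
  assumes "x \<le> 3 * k" "y \<le> 3 * k"
  shows "(\<Sum>l\<le>3 * k. tri_entry x l * tri_inv_entry l y) = of_bool (x = y)"
proof -
  \<comment> \<open>This is where a ceiling divisible by 3 is used: 3k + 1 is congruent to 1 mod 3,
    so it could only be adjacent to some y > 3k + 1.\<close>
  have "tri_inv_entry (Suc (3 * k)) y = 0"
    using assms by (simp add: tri_inv_entry_def pv_adj_def triple_mod_simps)
  then have "(\<Sum>l\<le>3 * k. tri_entry x l * tri_inv_entry l y) =
      (if x = 0 then 0 else tri_inv_entry (x - 1) y) - tri_inv_entry x y + tri_inv_entry (Suc x) y"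
    using assms by (intro sum_tri_entry) auto
  also have "\<dots> = of_bool (x = y)"
    using tri_inv_entry_rec0[of y] tri_inv_entry_rec[of "x - 1" y] by (cases x) auto
  finally show ?thesis .
qed

text \<open>Both matrices are symmetric, so this is the transpose of
  \<open>tri_inverse_right\<close>.\<close>

lemma tri_inverse_left:
  assumes "x \<le> 3 * k" "y \<le> 3 * k"
  shows "(\<Sum>l\<le>3 * k. tri_inv_entry x l * tri_entry l y) = (of_bool (x = y) :: 'a::comm_ring_1)"
proof -
  have "tri_inv_entry x l * tri_entry l y = (tri_entry y l * tri_inv_entry l x :: 'a)" for l
    by (auto simp: tri_inv_entry_def tri_entry_def pv_adj_def of_bool_def)
  then show ?thesis
    by (simp only: tri_inverse_right[OF assms(2,1)] eq_commute[of x y])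
qed

definition jacobi_inv_entry :: "(nat \<Rightarrow> 'a::field) \<Rightarrow> nat \<Rightarrow> nat \<Rightarrow> 'a" where
  "jacobi_inv_entry V x y = tri_inv_entry x y * ((\<Prod>i\<le>y. V i) / (\<Prod>i<x. V i))"

text \<open>With P(m) the product of the first m values of V, the factor P(y) / P(x + 1) is 1 / V x
  on the diagonal, 1 / (V x * V y) for x = y + 1, and 1 for y = x + 1.\<close>

lemma jacobi_entry_eq:
  fixes V b lam :: "nat \<Rightarrow> 'a::field"
  assumes "\<And>i. V i \<noteq> 0" and "\<And>i. b i = - inverse (V i)"
    and "\<And>i. i \<ge> 1 \<Longrightarrow> lam i = inverse (V i) * inverse (V (i - 1))"
  shows "jacobi_entry b lam x y = tri_entry x y * ((\<Prod>i<y. V i) / (\<Prod>i\<le>x. V i))"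
proof -
  have nz: "(\<Prod>i<m. V i) \<noteq> 0" for m
    using assms(1) by simp
  have "lam (Suc y) = inverse (V (Suc y)) * inverse (V y)"
    using assms(3)[of "Suc y"] by simp
  note entries = this assms(1,2) nz
  show ?thesis
    by (simp add: jacobi_entry_def tri_entry_def entries field_simps flip: lessThan_Suc_atMost)
qed

text \<open>The diagonal factors indexed by l cancel in both products, which reduces the claim to
  the integer matrices.\<close>

lemma jacobi_inverse:
  fixes V b lam :: "nat \<Rightarrow> 'a::field"
  assumes V: "\<And>i. V i \<noteq> 0" "\<And>i. b i = - inverse (V i)"
    "\<And>i. i \<ge> 1 \<Longrightarrow> lam i = inverse (V i) * inverse (V (i - 1))"
    and xy: "x \<le> 3 * k" "y \<le> 3 * k"
  shows "(\<Sum>l\<le>3 * k. jacobi_entry b lam x l * jacobi_inv_entry V l y) = of_bool (x = y)"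
    and "(\<Sum>l\<le>3 * k. jacobi_inv_entry V x l * jacobi_entry b lam l y) = of_bool (x = y)"
proof -
  have nz: "(\<Prod>i<n. V i) \<noteq> 0" "(\<Prod>i\<le>n. V i) \<noteq> 0" for n
    using V by simp_all
  have entry: "jacobi_entry b lam x y = tri_entry x y * ((\<Prod>i<y. V i) / (\<Prod>i\<le>x. V i))" for x y
    using V by (intro jacobi_entry_eq) auto
  have "(\<Sum>l\<le>3 * k. jacobi_entry b lam x l * jacobi_inv_entry V l y)
      = (\<Sum>l\<le>3 * k. tri_entry x l * tri_inv_entry l y) * ((\<Prod>i\<le>y. V i) / (\<Prod>i\<le>x. V i))"
    unfolding sum_distrib_right entry jacobi_inv_entry_def
    by (intro sum.cong) (simp_all add: nz)
  then show "(\<Sum>l\<le>3 * k. jacobi_entry b lam x l * jacobi_inv_entry V l y) = of_bool (x = y)"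
    using tri_inverse_right[OF xy, where 'a='a] nz by simp
  have "(\<Sum>l\<le>3 * k. jacobi_inv_entry V x l * jacobi_entry b lam l y)
      = (\<Sum>l\<le>3 * k. tri_inv_entry x l * tri_entry l y) * ((\<Prod>i<y. V i) / (\<Prod>i<x. V i))"
    unfolding sum_distrib_right entry jacobi_inv_entry_def
    by (intro sum.cong) (simp_all add: nz)
  then show "(\<Sum>l\<le>3 * k. jacobi_inv_entry V x l * jacobi_entry b lam l y) = of_bool (x = y)"
    using tri_inverse_left[OF xy, where 'a='a] nz by simp
qed


section \<open>Linear recurrences for entries of matrix powers\<close>

text \<open>Gaussian elimination: a pivot vector removes coordinate s from the other vectors,
  leaving one coordinate and one vector fewer.\<close>

lemma ex_nontrivial_linear_relation:
  fixes v :: "'i \<Rightarrow> 's \<Rightarrow> 'a::field"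
  assumes "finite S" "finite J" "card S < card J"
  shows "\<exists>c. (\<exists>j\<in>J. c j \<noteq> 0) \<and> (\<forall>s\<in>S. (\<Sum>j\<in>J. c j * v j s) = 0)"
  using assms
proof (induction S arbitrary: J v rule: finite_induct)
  case empty
  then show ?case
    by (intro exI[of _ "\<lambda>_. 1"]) (auto simp: card_gt_0_iff)
next
  case (insert s S)
  show ?case
  proof (cases "\<forall>j\<in>J. v j s = 0")
    case True
    then show ?thesis
      using insert.IH[of J v] insert.prems insert.hyps by auto
  next
    case False
    then obtain j0 where j0: "j0 \<in> J" "v j0 s \<noteq> 0" by blast
    define J' where "J' = J - {j0}"
    have J': "finite J'" "card S < card J'" "J = insert j0 J'" "j0 \<notin> J'"
      using insert j0 by (auto simp: J'_def)
    obtain c where c: "\<exists>j\<in>J'. c j \<noteq> 0"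
      "\<And>t. t \<in> S \<Longrightarrow> (\<Sum>j\<in>J'. c j * (v j t - v j s / v j0 s * v j0 t)) = 0"
      using insert.IH[OF J'(1,2), of "\<lambda>j t. v j t - v j s / v j0 s * v j0 t"] by blast
    \<comment> \<open>The pivot coefficient forced by coordinate s; with it the other coordinates
      reduce to the relation among the eliminated vectors.\<close>
    define e where "e = - (\<Sum>j\<in>J'. c j * v j s) / v j0 s"
    define c' where "c' = c(j0 := e)"
    have sum': "(\<Sum>j\<in>J. c' j * v j t) = e * v j0 t + (\<Sum>j\<in>J'. c j * v j t)" for t
    proof -
      have "(\<Sum>j\<in>J'. c' j * v j t) = (\<Sum>j\<in>J'. c j * v j t)"
        using J'(4) by (intro sum.cong) (auto simp: c'_def)
      then show ?thesis
        using J' by (simp add: c'_def)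
    qed
    have "(\<Sum>j\<in>J. c' j * v j t) = 0" if "t \<in> insert s S" for t
    proof (cases "t = s")
      case True
      then show ?thesis using j0 by (simp add: sum' e_def)
    next
      case False
      have "(\<Sum>j\<in>J'. c j * (v j t - v j s / v j0 s * v j0 t))
          = (\<Sum>j\<in>J'. c j * v j t) - (\<Sum>j\<in>J'. c j * v j s) / v j0 s * v j0 t"
        by (simp add: right_diff_distrib sum_subtractf sum_distrib_right sum_divide_distrib
            flip: mult.assoc)
      with c(2)[of t] False that show ?thesis
        by (simp add: sum' e_def)
    qed
    moreover have "\<exists>j\<in>J. c' j \<noteq> 0"
      using c(1) J' by (auto simp: c'_def)
    ultimately show ?thesis by blast
  qed
qed

text \<open>
  A linear relation among the row vectors \<open>w 0, \<dots>, w (K + 1)\<close> is shifted to every index by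
  \<open>A\<close> and \<open>B\<close>; cutting it at its lowest and highest nonzero coefficients gives a recurrence whose
  last coefficient is nonzero.
\<close>

lemma is_recurrence_extension_row_orbit:
  fixes w :: "int \<Rightarrow> nat \<Rightarrow> 'a::field"
  assumes A: "\<And>N s. s \<le> K \<Longrightarrow> w (N + 1) s = (\<Sum>l\<le>K. w N l * A l s)"
    and B: "\<And>N s. s \<le> K \<Longrightarrow> w (N - 1) s = (\<Sum>l\<le>K. w N l * B l s)"
    and nz: "t \<le> K" "w 0 t \<noteq> 0"
    and s: "s \<le> K"
  shows "is_recurrence_extension (\<lambda>N. w (int N) s) (\<lambda>N. w N s)"
proof -
  \<comment> \<open>There are K + 2 rows but only K + 1 coordinates.\<close>
  obtain p where p: "\<exists>j\<in>{..Suc K}. p j \<noteq> 0"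
    "\<And>u. u \<le> K \<Longrightarrow> (\<Sum>j\<le>Suc K. p j * w (int j) u) = 0"
    using ex_nontrivial_linear_relation[of "{..K}" "{..Suc K}" "\<lambda>j. w (int j)"] by auto
  have shift: "\<forall>u\<le>K. (\<Sum>j\<le>Suc K. p j * w (N + int j) u) = 0" for N
  proof (induction N rule: int_induct[where k = 0])
    case base
    then show ?case using p(2) by simp
  next
    case (step1 N)
    show ?case
    proof (intro allI impI)
      fix u assume u: "u \<le> K"
      have "(\<Sum>j\<le>Suc K. p j * w (N + 1 + int j) u)
          = (\<Sum>j\<le>Suc K. \<Sum>l\<le>K. p j * w (N + int j) l * A l u)"
        using A[OF u, of "N + int _"] by (simp add: algebra_simps sum_distrib_left)
      also have "\<dots> = (\<Sum>l\<le>K. (\<Sum>j\<le>Suc K. p j * w (N + int j) l) * A l u)"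
        unfolding sum_distrib_right by (rule sum.swap)
      also have "\<dots> = 0"
        using step1 by (intro sum.neutral) auto
      finally show "(\<Sum>j\<le>Suc K. p j * w (N + 1 + int j) u) = 0" .
    qed
  next
    case (step2 N)
    show ?case
    proof (intro allI impI)
      fix u assume u: "u \<le> K"
      have "(\<Sum>j\<le>Suc K. p j * w (N - 1 + int j) u)
          = (\<Sum>j\<le>Suc K. \<Sum>l\<le>K. p j * w (N + int j) l * B l u)"
        using B[OF u, of "N + int _"] by (simp add: algebra_simps sum_distrib_left)
      also have "\<dots> = (\<Sum>l\<le>K. (\<Sum>j\<le>Suc K. p j * w (N + int j) l) * B l u)"
        unfolding sum_distrib_right by (rule sum.swap)
      also have "\<dots> = 0"
        using step2 by (intro sum.neutral) auto
      finally show "(\<Sum>j\<le>Suc K. p j * w (N - 1 + int j) u) = 0" .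
    qed
  qed
  define J where "J = {j. j \<le> Suc K \<and> p j \<noteq> 0}"
  define lo hi where "lo = Min J" and "hi = Max J"
  have J: "finite J" "J \<noteq> {}"
    using p(1) by (auto simp: J_def)
  then have lohi: "lo \<in> J" "hi \<in> J" 
    "\<And>j. j \<le> Suc K \<Longrightarrow> p j \<noteq> 0 \<Longrightarrow> lo \<le> j \<and> j \<le> hi"
    by (simp_all add: lo_def hi_def J_def[symmetric]) (auto simp: J_def)
  have rel: "(\<Sum>j=lo..hi. p j * w (N + int j) u) = 0" if "u \<le> K" for N u
  proof -
    have "(\<Sum>j=lo..hi. p j * w (N + int j) u) = (\<Sum>j\<le>Suc K. p j * w (N + int j) u)"
      by (rule sum.mono_neutral_left) (use lohi in \<open>force simp: J_def\<close>)+
    then show ?thesis using shift that by simp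
  qed
  have "lo < hi"
  proof (rule ccontr)
    assume "\<not> lo < hi"
    then have "lo = hi" using lohi by (force simp: J_def)
    then show False
      \<comment> \<open>A single surviving coefficient, shifted to index 0, would force
        \<open>w 0 t = 0\<close>.\<close>
      using rel[OF nz(1), of "- int lo"] nz lohi by (simp add: J_def)
  qed
  define d where "d = hi - lo"
  \<comment> \<open>The relation solved for its highest term; \<open>c d\<close> is nonzero because
    \<open>p lo\<close> is.\<close>
  define c where "c i = - p (hi - i) / p hi" for i
  have "d \<ge> 1" using \<open>lo < hi\<close> by (simp add: d_def)
  have "c d \<noteq> 0" using lohi \<open>lo < hi\<close> by (simp add: c_def d_def J_def)
  have rec: "w N s = (\<Sum>i=1..d. c i * w (N - int i) s)" for N
  proof -
    have "(\<Sum>j=lo..<hi. p j * w (N - int hi + int j) s) = (\<Sum>i=1..d. p (hi - i) * w (N - int i) s)"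
      by (rule sum.reindex_bij_witness[of _ "\<lambda>i. hi - i" "\<lambda>j. hi - j"])
         (use \<open>lo < hi\<close> in \<open>auto simp: d_def of_nat_diff algebra_simps\<close>)
    moreover have "(\<Sum>j=lo..hi. p j * w (N - int hi + int j) s)
        = (\<Sum>j=lo..<hi. p j * w (N - int hi + int j) s) + p hi * w N s"
      using \<open>lo < hi\<close> by (simp add: sum.last_plus add.commute)
    ultimately have "p hi * w N s = - (\<Sum>i=1..d. p (hi - i) * w (N - int i) s)"
      using rel[OF s, of "N - int hi"] by (simp add: add_eq_0_iff)
    then show ?thesis
      using lohi by (simp add: c_def J_def field_simps sum_negf flip: sum_divide_distrib)
  qed
  show ?thesis
    unfolding is_recurrence_extension_def
  proof (intro exI conjI allI impI)
    show "1 \<le> d" "c d \<noteq> 0" by fact+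
    show "w N s = (\<Sum>i=1..d. c i * w (N - int i) s)" for N by (rule rec)
    show "w (int N) s = (\<Sum>i=1..d. c i * w (int (N - i)) s)" if "d \<le> N" for N
      unfolding rec[of "int N"] using that by (intro sum.cong) (auto simp: of_nat_diff)
  qed simp
qed


section \<open>The reciprocity formula\<close>

lemma indet_nonzero: "(indet i :: 'k::field ratfun) \<noteq> 0"
proof -
  have "Poly_Mapping.single (Poly_Mapping.single i (1 :: nat)) (1 :: 'k) \<noteq> 0"
    by (metis lookup_single_eq lookup_zero one_neq_zero)
  then show ?thesis
    by (simp add: indet_def Zero_fract_def eq_fract)
qed

text \<open>Meant for n \<ge> 1: a product of n inverse matrices has n - 1 intermediate
  indices.\<close>

definition mu_neg :: "nat \<Rightarrow> (nat \<Rightarrow> 'a::field) \<Rightarrow> nat \<Rightarrow> nat \<Rightarrow> nat \<Rightarrow> 'a" where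
  "mu_neg K V n r s = pv_sign r * pv_sign s * (-1) ^ n * ((\<Prod>i\<le>s. V i) / (\<Prod>i<r. V i)) *
     pv_sum K V (n - 1) r s"

lemma mu_neg_1: "mu_neg K V 1 r s = jacobi_inv_entry V r s"
  by (simp add: mu_neg_def jacobi_inv_entry_def tri_inv_entry_def pv_sum_0)

lemma mu_neg_Suc:
  assumes "\<And>i. V i \<noteq> 0" "n \<ge> 1"
  shows "mu_neg K V (Suc n) r s = (\<Sum>l\<le>K. mu_neg K V n r l * jacobi_inv_entry V l s)"
proof -
  obtain m where m: "n = Suc m"
    using assms by (cases n) auto
  let ?c = "pv_sign r * pv_sign s * (-1) ^ Suc n * ((\<Prod>i\<le>s. V i) / (\<Prod>i<r. V i))"
  have "mu_neg K V n r l * jacobi_inv_entry V l s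
      = ?c * (pv_sum K V m r l * V l * of_bool (pv_adj l s))" for l
  proof -
    have "(\<Prod>i<l. V i) \<noteq> 0" using assms by simp
    then have "(\<Prod>i\<le>l. V i) / (\<Prod>i<l. V i) = V l"
      by (simp flip: lessThan_Suc_atMost)
    \<comment> \<open>The new index l occurs with its sign twice, and its diagonal factors leave
      exactly one \<open>V l\<close>. The minus sign of \<open>tri_inv_entry\<close> raises the
      power of -1 in \<open>?c\<close>.\<close>
    moreover have "mu_neg K V n r l * jacobi_inv_entry V l s = (pv_sign l * pv_sign l) * ?c *
        (pv_sum K V m r l * ((\<Prod>i\<le>l. V i) / (\<Prod>i<l. V i)) * of_bool (pv_adj l s))"
      by (simp add: mu_neg_def jacobi_inv_entry_def tri_inv_entry_def m
          del: pv_sign_square)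
    ultimately show ?thesis by simp
  qed
  then have "(\<Sum>l\<le>K. mu_neg K V n r l * jacobi_inv_entry V l s) = ?c * pv_sum K V (Suc m) r s"
    by (simp only: pv_sum_Suc sum_distrib_left)
  then show ?thesis
    by (simp only: mu_neg_def[of K V "Suc (Suc m)"] m diff_Suc_1 pv_sum_Suc sum_distrib_left)
qed

lemma mu_int_neg:
  fixes V b lam :: "nat \<Rightarrow> 'a::field"
  assumes V: "\<And>i. V i \<noteq> 0" "\<And>i. b i = - inverse (V i)"
    "\<And>i. i \<ge> 1 \<Longrightarrow> lam i = inverse (V i) * inverse (V (i - 1))"
    and n: "n \<ge> 1" and r: "r \<le> 3 * k" and s: "s \<le> 3 * k"
  shows "mu_int (3 * k) b lam (- int n) r s = mu_neg (3 * k) V n r s"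
proof -
  define K where "K = 3 * k"
  define A where "A = jacobi_entry b lam"
  define B where "B = jacobi_inv_entry V"
  \<comment> \<open>The candidate extension, glued from path sums and claimed values; it turns out
    to be the two-sided orbit of the unit row r under A and B.\<close>
  define w where "w N t = (if N \<ge> 0 then mu K b lam (nat N) r t else mu_neg K V (nat (- N)) r t)"
    for N t
  have w0: "w 0 t = of_bool (r = t)" for t
    using r by (simp add: w_def mu_0 K_def)
  have inv: "(\<Sum>l\<le>K. A x l * B l y) = of_bool (x = y)" "(\<Sum>l\<le>K. B x l * A l y) = of_bool (x = y)"
    if "x \<le> K" "y \<le> K" for x y
    using jacobi_inverse[of V b lam, OF V] that by (simp_all add: A_def B_def K_def)
  \<comment> \<open>Stated for arbitrary C and D so that it serves both orders, A after B and B
    after A.\<close>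
  have cancel: "(\<Sum>l\<le>K. (\<Sum>m\<le>K. f m * C m l) * D l t) = f t"
    if "\<And>x. x \<le> K \<Longrightarrow> (\<Sum>l\<le>K. C x l * D l t) = of_bool (x = t)" "t \<le> K"
    for f :: "nat \<Rightarrow> 'a" and C D t
  proof -
    have "(\<Sum>l\<le>K. (\<Sum>m\<le>K. f m * C m l) * D l t) = (\<Sum>m\<le>K. f m * (\<Sum>l\<le>K. C m l * D l t))"
      unfolding sum_distrib_left sum_distrib_right by (subst sum.swap) (simp add: mult.assoc)
    also have "\<dots> = (\<Sum>m\<le>K. f m * of_bool (m = t))"
      using that by simp
    also have "\<dots> = f t"
      using that by (simp add: of_bool_def if_distrib cong: if_cong)
    finally show ?thesis .
  qed
  have up: "w (N + 1) t = (\<Sum>l\<le>K. w N l * A l t)" if "N \<ge> 0" "t \<le> K" for N t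
    using that mu_Suc[of t K b lam "nat N" r] by (simp add: w_def A_def nat_add_distrib)
  have down: "w (N - 1) t = (\<Sum>l\<le>K. w N l * B l t)" if "N \<le> 0" "t \<le> K" for N t
  proof (cases "N = 0")
    case True
    have "(\<Sum>l\<le>K. w 0 l * B l t) = (\<Sum>l\<le>K. if r = l then B l t else 0)"
      by (intro sum.cong) (auto simp: w0)
    also have "\<dots> = w (- 1) t"
      using r by (simp add: w_def mu_neg_1[simplified] B_def K_def)
    finally show ?thesis
      using True by simp
  next
    case False
    then have "nat (1 - N) = Suc (nat (- N))" using that by simp
    then show ?thesis
      using False that mu_neg_Suc[of V "nat (- N)" K r t, OF V(1)] by (simp add: w_def B_def)
  qed
  \<comment> \<open>\<open>up\<close> covers only N \<ge> 0. For N < 0 the row at N is the row at N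
    + 1 times B, and A undoes B. \<open>wB\<close> extends \<open>down\<close> in the same
    way.\<close>
  have wA: "w (N + 1) t = (\<Sum>l\<le>K. w N l * A l t)" if t: "t \<le> K" for N t
  proof (cases "N \<ge> 0")
    case False
    then have "(\<Sum>l\<le>K. w N l * A l t) = (\<Sum>l\<le>K. (\<Sum>m\<le>K. w (N + 1) m * B m l) * A l t)"
      using down[of "N + 1"] by simp
    then show ?thesis
      using cancel[of B A t "w (N + 1)"] inv t by simp
  qed (use up t in simp)
  have wB: "w (N - 1) t = (\<Sum>l\<le>K. w N l * B l t)" if t: "t \<le> K" for N t
  proof (cases "N \<le> 0")
    case False
    then have "(\<Sum>l\<le>K. w N l * B l t) = (\<Sum>l\<le>K. (\<Sum>m\<le>K. w (N - 1) m * A m l) * B l t)"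
      using up[of "N - 1"] by simp
    then show ?thesis
      using cancel[of A B t "w (N - 1)"] inv t by simp
  qed (use down t in simp)
  have "is_recurrence_extension (\<lambda>N. w (int N) s) (\<lambda>N. w N s)"
    \<comment> \<open>The nonzero entry required at index 0 is \<open>w 0 r = 1\<close>.\<close>
    by (rule is_recurrence_extension_row_orbit[of K w A B r])
       (use wA wB w0 r s in \<open>simp_all add: K_def\<close>)
  then have "recurrence_extension (\<lambda>N. mu K b lam N r s) = (\<lambda>N. w N s)"
    by (intro recurrence_extension_eq) (simp add: w_def)
  then show ?thesis
    using n by (simp add: mu_int_def w_def flip: K_def)
qed

theorem theorem5p8:
  fixes V b lam :: "nat \<Rightarrow> 'k::field ratfun" and k n r s :: nat
  assumes "\<And>i. V i = indet i"
    and "\<And>i. b i = - inverse (V i)"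
    and "\<And>i. i \<ge> 1 \<Longrightarrow> lam i = inverse (V i) * inverse (V (i - 1))"
    and "k \<ge> 1" and "n \<ge> 1" and "r \<le> 3 * k" and "s \<le> 3 * k"
  shows "mu_int (3 * k) b lam (- int n) r s =
    (-1) ^ ((r + 1) div 3 + (s + 1) div 3 + n) * ((\<Prod>i\<le>s. V i) / (\<Prod>i<r. V i)) *
    (\<Sum>a\<in>modified_PV3 (3 * k) (n - 1) r s. pv_weight V a)"
proof -
  have "V i \<noteq> 0" for i
    using assms(1) indet_nonzero by simp
  then have "mu_int (3 * k) b lam (- int n) r s = mu_neg (3 * k) V n r s"
    using assms by (intro mu_int_neg) auto
  then show ?thesis
    by (simp add: mu_neg_def pv_sign_def pv_sum_def power_add)
qed

end
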